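(* Let $0<q<1$ and let $0\le\underline{k}\le\overline{k}$ be integers. As formal Laurent series in $x$ with coefficients in $\mathbb{R}[y]$, $$\Pi_{\underline{k}\le\overline{k}}(x,y)=\sum_{n,m}\pi_{\underline{k}\le\overline{k}}(n,m)x^ny^m=\frac{1-qx}{(1-q)\,x\,\Big(1-x-(y-1)(1-q)\big(q^{\underline{k}}x^{\underline{k}+1}-q^{\overline{k}+1}x^{\overline{k}+2}\big)\Big)},$$ and, for every $m\ge 0$, $$[y^m]\Pi_{\underline{k}\le\overline{k}}(x,y)=\frac{(1-q)^{m-1}(1-qx)\big(q^{\underline{k}}x^{\underline{k}+1}-q^{\overline{k}+1}x^{\overline{k}+2}\big)^m}{x\Big(1-x+(1-q)\big(q^{\underline{k}}x^{\underline{k}+1}-q^{\overline{k}+1}x^{\overline{k}+2}\big)\Big)^{m+1}}.$$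
   Context: A random $n$-string is a binary string of length $n$ whose bits are independent, each equal to $1$ with probability $q$. A run of ones is a maximal block of consecutive ones, flanked on each side by a zero or by the start/end of the string. Null runs (length $0$) of ones also count: there is one between every two consecutive zeros, one before an initial zero and one after a final zero; thus a string with $z$ zeros has exactly $z+1$ runs of ones (including null ones); the empty string has one null run. For $n\ge 0$, $\pi_{\underline{k}\le\overline{k}}(n,m)$ is the probability that a random $n$-string contains exactly $m$ runs of ones whose length lies in $[\underline{k},\overline{k}]$ (null runs included if $\underline{k}=0$). By convention $\pi_{\underline{k}\le\overline{k}}(-1,m)=1/(1-q)$ if $m=0$ and $0$ otherwise, and $\pi_{\underline{k}\le\overline{k}}(n,m)=0$ if $n<-1$ or $m<0$. The sum is over all integers $n,m$. *)

theory Defs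
  imports
    "HOL-Probability.Probability"
    "HOL-Computational_Algebra.Formal_Laurent_Series"
begin

(* Strings are lists of booleans, True standing for the bit 1. A run of ones is represented by the
   pair (i, j) of its start position and the position just after its end, so its length is j - i.
   For i = j the two maximality conditions say precisely that the gap before position i is flanked
   on each side by a zero or by an end of the string, i.e. that there is a null run there. *)

definition runs_of_ones :: "bool list \<Rightarrow> (nat \<times> nat) set" where
  "runs_of_ones s = {(i, j). i \<le> j \<and> j \<le> length s \<and> (\<forall>t. i \<le> t \<and> t < j \<longrightarrow> s ! t)
     \<and> (i = 0 \<or> \<not> s ! (i - 1)) \<and> (j = length s \<or> \<not> s ! j)}"

definition num_runs :: "nat \<Rightarrow> nat \<Rightarrow> bool list \<Rightarrow> nat" where
  "num_runs kl ku s = card {(i, j) \<in> runs_of_ones s. kl \<le> j - i \<and> j - i \<le> ku}"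

definition random_string :: "real \<Rightarrow> nat \<Rightarrow> bool list pmf" where
  "random_string q n = replicate_pmf n (bernoulli_pmf q)"

definition run_prob :: "real \<Rightarrow> nat \<Rightarrow> nat \<Rightarrow> int \<Rightarrow> int \<Rightarrow> real" where
  "run_prob q kl ku n m =
     (if n < -1 \<or> m < 0 then 0
      else if n = -1 then (if m = 0 then 1 / (1 - q) else 0)
      else measure_pmf.prob (random_string q (nat n)) {s. int (num_runs kl ku s) = m})"

(* The generating function, with coefficients in R[y]. Negative powers of y do not occur because
   run_prob vanishes for negative m; the lemma run_gf_coeff below shows that the coefficients are
   indeed the values of run_prob, i.e. that Abs_fls and Abs_poly are applied within their domains. *)

definition run_gf :: "real \<Rightarrow> nat \<Rightarrow> nat \<Rightarrow> real poly fls" where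
  "run_gf q kl ku = Abs_fls (\<lambda>n. Abs_poly (\<lambda>m. run_prob q kl ku n (int m)))"

definition y_coeff :: "nat \<Rightarrow> real poly fls \<Rightarrow> real fls" where
  "y_coeff m F = Abs_fls (\<lambda>n. poly.coeff (fls_nth F n) m)"

(* The quotient of a by a unit b of a commutative ring. The type real poly fls has no usable
   division operator, since its coefficient ring is not a field. *)

definition unit_quotient :: "'a::comm_ring_1 \<Rightarrow> 'a \<Rightarrow> 'a" where
  "unit_quotient a b = a * (THE c. b * c = 1)"

lemma unit_quotient_eq_iff:
  fixes a b c :: "'a::comm_ring_1"
  assumes "b dvd 1"
  shows "c = unit_quotient a b \<longleftrightarrow> c * b = a"
proof -
  from assms obtain d where d: "b * d = 1"
    by (metis dvdE)
  have "(THE c. b * c = 1) = d"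
  proof (rule the_equality)
    show "b * d = 1" by (rule d)
    show "e = d" if "b * e = 1" for e
      using that by (metis d mult.assoc mult.commute mult_1_right)
  qed
  then have "unit_quotient a b = a * d"
    by (simp add: unit_quotient_def)
  then show ?thesis
    by (metis d mult.assoc mult.commute mult_1_right)
qed

lemma num_runs_le: "num_runs kl ku s \<le> (length s + 1) * (length s + 1)"
proof -
  have "{(i, j) \<in> runs_of_ones s. kl \<le> j - i \<and> j - i \<le> ku} \<subseteq> {..length s} \<times> {..length s}"
    by (auto simp: runs_of_ones_def)
  from card_mono[OF _ this] show ?thesis
    by (simp add: num_runs_def)
qed

lemma run_prob_eq_0:
  assumes "int ((nat n + 1) * (nat n + 1)) < m"
  shows "run_prob q kl ku n m = 0"
proof -
  have "num_runs kl ku s \<le> (nat n + 1) * (nat n + 1)" if "s \<in> set_pmf (random_string q (nat n))" for s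
    using that num_runs_le[of kl ku s] by (simp add: random_string_def set_replicate_pmf)
  then have "set_pmf (random_string q (nat n)) \<inter> {s. int (num_runs kl ku s) = m} = {}"
    using assms of_nat_le_iff[where 'a = int] by (force simp del: of_nat_le_iff of_nat_mult of_nat_add)
  then have "measure_pmf.prob (random_string q (nat n)) {s. int (num_runs kl ku s) = m} = 0"
    by (simp add: measure_pmf_zero_iff)
  moreover have "m \<noteq> 0"
    using assms by linarith
  ultimately show ?thesis
    by (simp add: run_prob_def)
qed

lemma run_gf_coeff: "poly.coeff (fls_nth (run_gf q kl ku) n) m = run_prob q kl ku n (int m)"
proof -
  have "fls_nth (run_gf q kl ku) n = Abs_poly (\<lambda>m. run_prob q kl ku n (int m))"
    unfolding run_gf_def
    by (rule nth_Abs_fls_lower_bound[of "-1"]) (simp add: run_prob_def zero_poly_def)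
  moreover have "poly.coeff (Abs_poly (\<lambda>m. run_prob q kl ku n (int m))) = (\<lambda>m. run_prob q kl ku n (int m))"
    by (rule coeff_Abs_poly[of "(nat n + 1) * (nat n + 1)"])
       (rule run_prob_eq_0, simp only: of_nat_less_iff)
  ultimately show ?thesis
    by simp
qed

lemma y_coeff_nth: "fls_nth (y_coeff m F) n = poly.coeff (fls_nth F n) m"
proof -
  have "fls_nth F k = 0" if "k < fls_subdegree F" for k
    using that by simp
  then show ?thesis
    unfolding y_coeff_def by (intro nth_Abs_fls_lower_bound[of "fls_subdegree F"]) auto
qed

end

theory Submission
  imports Defs
begin

text \<open>
  The idea is a renewal argument. Read a random string up to its first zero: the \<open>j\<close> ones before
  it form the first run, with probability \<open>q ^ j * (1 - q)\<close>, and what follows the zero is again a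
  random string, whose runs are exactly the remaining runs (\<open>runs_of_ones_replicate_Cons\<close>). A run
  contributes \<open>y\<close> if its length is counted and 1 otherwise. The string without a zero fits the same
  pattern, thanks to the value \<open>1 / (1 - q)\<close> assigned to length \<open>-1\<close>. So the power series
  \<open>G = x \<Pi>\<close> satisfies \<open>G = 1 / (1 - q) + (1 - q) x W G\<close>, where \<open>W\<close> is the series of the weights
  of a single run (\<open>run_series_renewal\<close>). The weights are constant apart from two jumps, so
  \<open>(1 - q x) W = 1 + (y - 1) (q ^ kl x ^ kl - q ^ (ku + 1) x ^ (ku + 1))\<close>
  (\<open>weight_series_closed_form\<close>), and eliminating \<open>W\<close> yields the first formula.

  The denominator is invertible because it is a product of \<open>1 - q\<close>, of \<open>x\<close>, and of a power series
  with constant coefficient 1. It is linear in \<open>y\<close>, so the coefficients of the powers of \<open>y\<close> form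
  a geometric sequence (\<open>y_coeff_run_gf_recurrence\<close>), which is the second formula.
\<close>

section \<open>Splitting off the first run of ones\<close>

lemma runs_of_ones_replicate:
  "runs_of_ones (replicate a True) = {(0, a)}"
proof -
  have "(i, j) \<in> runs_of_ones (replicate a True) \<longleftrightarrow> i = 0 \<and> j = a" for i j
    by (auto simp: runs_of_ones_def)
  then show ?thesis by auto
qed

text \<open>
  The zero at position \<open>a\<close> ends the first run, and it plays the part of the start of the string
  for \<open>s\<close>: a run of \<open>s\<close> that starts at 0, be it null or not, becomes a run flanked by that
  zero. Hence the later runs are exactly the runs of \<open>s\<close>, shifted by \<open>a + 1\<close>.
\<close>

lemma runs_of_ones_replicate_Cons:
  "runs_of_ones (replicate a True @ False # s) =
     insert (0, a) ((\<lambda>(i, j). (i + Suc a, j + Suc a)) ` runs_of_ones s)"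
proof -
  let ?s = "replicate a True @ False # s"
  have nth_le: "?s ! t \<longleftrightarrow> t < a" if "t \<le> a" for t
    using that by (auto simp: nth_append)
  have nth_gt: "?s ! (t + Suc a) = s ! t" for t
    by (auto simp: nth_append)
  have first: "(0, j) \<in> runs_of_ones ?s \<longleftrightarrow> j = a" for j
  proof
    assume j: "(0, j) \<in> runs_of_ones ?s"
    have "\<not> a < j" using j nth_le[of a] by (auto simp: runs_of_ones_def)
    moreover have "\<not> j < a" using j nth_le[of j] by (auto simp: runs_of_ones_def)
    ultimately show "j = a" by simp
  qed (use nth_le in \<open>auto simp: runs_of_ones_def\<close>)
  have later: "(i + Suc a, j + Suc a) \<in> runs_of_ones ?s \<longleftrightarrow> (i, j) \<in> runs_of_ones s" for i j
  proof -
    have "(\<forall>t. i + Suc a \<le> t \<and> t < j + Suc a \<longrightarrow> ?s ! t) \<longleftrightarrow> (\<forall>t. i \<le> t \<and> t < j \<longrightarrow> s ! t)"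
      (is "?L \<longleftrightarrow> ?R")
    proof
      assume ?L then show ?R using nth_gt by (metis add_le_cancel_right add_less_cancel_right)
    next
      assume R: ?R
      show ?L
      proof (intro allI impI)
        fix t assume t: "i + Suc a \<le> t \<and> t < j + Suc a"
        then have "i \<le> t - Suc a \<and> t - Suc a < j" by linarith
        then have "s ! (t - Suc a)" using R by blast
        then show "?s ! t" using nth_gt[of "t - Suc a"] t by simp
      qed
    qed
    moreover have "?s ! (i + Suc a - 1) \<longleftrightarrow> i \<noteq> 0 \<and> s ! (i - 1)"
      using nth_gt[of "i - 1"] nth_le[of a] by (cases i) auto
    ultimately show ?thesis
      using nth_gt[of j] by (auto simp: runs_of_ones_def)
  qed
  have split: "i = 0 \<or> (Suc a \<le> i \<and> Suc a \<le> j)" if "(i, j) \<in> runs_of_ones ?s" for i j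
  proof (cases i)
    case (Suc i')
    then have "\<not> ?s ! i'" "i \<le> j" using that by (auto simp: runs_of_ones_def)
    then have "\<not> i' < a" using nth_le[of i'] by auto
    then show ?thesis using Suc \<open>i \<le> j\<close> by auto
  qed simp
  show ?thesis
  proof (intro equalityI subsetI)
    fix r assume r: "r \<in> runs_of_ones ?s"
    obtain i j where ij: "r = (i, j)" by fastforce
    show "r \<in> insert (0, a) ((\<lambda>(i, j). (i + Suc a, j + Suc a)) ` runs_of_ones s)"
    proof (cases "i = 0")
      case True then show ?thesis using r first ij by auto
    next
      case False
      then have "Suc a \<le> i" "Suc a \<le> j" using split r ij by auto
      then have "(i - Suc a, j - Suc a) \<in> runs_of_ones s" "r = (i - Suc a + Suc a, j - Suc a + Suc a)"
        using later[of "i - Suc a" "j - Suc a"] r ij by auto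
      then show ?thesis by (metis (mono_tags, lifting) image_eqI insertCI case_prod_conv)
    qed
  qed (use first later in auto)
qed

lemma finite_runs_of_ones: "finite (runs_of_ones s)"
  by (rule finite_subset[of _ "{..length s} \<times> {..length s}"]) (auto simp: runs_of_ones_def)

lemma num_runs_replicate: "num_runs kl ku (replicate a True) = of_bool (a \<in> {kl..ku})"
proof -
  have "{(i, j) \<in> runs_of_ones (replicate a True). kl \<le> j - i \<and> j - i \<le> ku} =
     (if a \<in> {kl..ku} then {(0, a)} else {})"
    by (auto simp: runs_of_ones_replicate)
  then show ?thesis by (simp add: num_runs_def)
qed

lemma num_runs_replicate_Cons:
  "num_runs kl ku (replicate a True @ False # s) = of_bool (a \<in> {kl..ku}) + num_runs kl ku s"
proof -
  let ?A = "{(i, j) \<in> runs_of_ones s. kl \<le> j - i \<and> j - i \<le> ku}"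
  let ?f = "\<lambda>(i::nat, j::nat). (i + Suc a, j + Suc a)"
  have "{(i, j) \<in> runs_of_ones (replicate a True @ False # s). kl \<le> j - i \<and> j - i \<le> ku} =
     (if a \<in> {kl..ku} then {(0, a)} else {}) \<union> ?f ` ?A"
    by (auto simp: runs_of_ones_replicate_Cons image_iff split_beta)
  moreover have "card ((if a \<in> {kl..ku} then {(0, a)} else {}) \<union> ?f ` ?A) =
     of_bool (a \<in> {kl..ku}) + card (?f ` ?A)"
    by (subst card_Un_disjoint) (auto intro: finite_subset[OF _ finite_runs_of_ones[of s]])
  moreover have "card (?f ` ?A) = card ?A"
    by (rule card_image) (auto simp: inj_on_def)
  ultimately show ?thesis by (simp add: num_runs_def)
qed

section \<open>The distribution of the number of runs\<close>

definition run_weight :: "nat \<Rightarrow> nat \<Rightarrow> nat \<Rightarrow> real poly" where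
  "run_weight kl ku j = (if j \<in> {kl..ku} then [:0, 1:] else 1)"

text \<open>
  The probability generating polynomial, in \<open>y\<close>, of the number of counted runs of a string that
  consists of \<open>a\<close> ones followed by \<open>n\<close> random bits. The offset \<open>a\<close> makes the recursion close
  under reading a single bit: a one extends the first run, and a zero completes it.
\<close>

primrec run_poly :: "real \<Rightarrow> nat \<Rightarrow> nat \<Rightarrow> nat \<Rightarrow> nat \<Rightarrow> real poly" where
  "run_poly q kl ku 0 a = run_weight kl ku a"
| "run_poly q kl ku (Suc n) a =
     smult q (run_poly q kl ku n (Suc a)) + smult (1 - q) (run_weight kl ku a * run_poly q kl ku n 0)"

lemma coeff_run_weight_times_pmf:
  assumes "\<And>m. coeff p m = pmf (map_pmf f P) m"
  shows "coeff (run_weight kl ku a * p) m = pmf (map_pmf (\<lambda>s. of_bool (a \<in> {kl..ku}) + f s) P) m"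
proof (cases "a \<in> {kl..ku}")
  case True
  have "coeff ([:0, 1:] * p) m = pmf (map_pmf (\<lambda>s. Suc (f s)) P) m"
    using assms by (cases m) (auto simp: pmf_map vimage_def coeff_pCons)
  then show ?thesis using True by (simp add: run_weight_def)
next
  case False
  then show ?thesis by (auto simp: run_weight_def assms)
qed

lemma smult_sum_right: "smult c (\<Sum>i\<in>A. f i) = (\<Sum>i\<in>A. smult c (f i))"
  by (induction A rule: infinite_finite_induct) (simp_all add: smult_add_right)

lemma coeff_run_poly:
  assumes "0 < q" "q < 1"
  shows "coeff (run_poly q kl ku n a) m =
    pmf (map_pmf (\<lambda>s. num_runs kl ku (replicate a True @ s)) (random_string q n)) m"
proof (induction n arbitrary: a m)
  case 0
  then show ?case
    by (auto simp: random_string_def run_weight_def num_runs_replicate coeff_pCons pmf_return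
        split: nat.splits)
next
  case (Suc n)
  let ?N = "\<lambda>a s. num_runs kl ku (replicate a True @ s)"
  have True_step: "?N a (True # s) = ?N (Suc a) s" for s
    by (simp add: replicate_app_Cons_same)
  have False_step: "?N a (False # s) = of_bool (a \<in> {kl..ku}) + ?N 0 s" for s
    by (simp add: num_runs_replicate_Cons)
  have "map_pmf (?N a) (random_string q (Suc n)) =
      bernoulli_pmf q \<bind> (\<lambda>b. map_pmf (\<lambda>s. ?N a (b # s)) (random_string q n))"
    by (simp add: random_string_def map_bind_pmf map_pmf_def bind_assoc_pmf bind_return_pmf)
  then have "pmf (map_pmf (?N a) (random_string q (Suc n))) m =
      q * pmf (map_pmf (?N (Suc a)) (random_string q n)) m +
      (1 - q) * pmf (map_pmf (\<lambda>s. of_bool (a \<in> {kl..ku}) + ?N 0 s) (random_string q n)) m"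
    using assms by (simp add: pmf_bind True_step False_step)
  also have "\<dots> = coeff (run_poly q kl ku (Suc n) a) m"
    using coeff_run_weight_times_pmf[OF Suc.IH] by (simp add: Suc.IH)
  finally show ?case ..
qed

text \<open>
  Conditioning on the number \<open>j\<close> of ones before the first zero. In the sum, that zero is bit number
  \<open>j\<close> and \<open>n - 1 - j\<close> bits remain; the last summand is the case of no zero.
\<close>

lemma run_poly_unfold:
  "run_poly q kl ku n a =
     (\<Sum>j<n. smult (q ^ j * (1 - q)) (run_weight kl ku (a + j) * run_poly q kl ku (n - 1 - j) 0)) +
     smult (q ^ n) (run_weight kl ku (a + n))"
proof (induction n arbitrary: a)
  case (Suc n)
  show ?case
    by (subst sum.lessThan_Suc_shift) (simp add: Suc[of "Suc a"] smult_add_right smult_sum_right mult.assoc)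
qed simp

section \<open>The functional equation\<close>

text \<open>
  The generating function multiplied by \<open>x\<close>, which makes it a power series: the coefficient at 0
  is the conventional value for strings of length \<open>-1\<close>.
\<close>

definition run_series :: "real \<Rightarrow> nat \<Rightarrow> nat \<Rightarrow> real poly fps" where
  "run_series q kl ku = Abs_fps (\<lambda>n. case n of 0 \<Rightarrow> [:1 / (1 - q):] | Suc k \<Rightarrow> run_poly q kl ku k 0)"

definition weight_series :: "real \<Rightarrow> nat \<Rightarrow> nat \<Rightarrow> real poly fps" where
  "weight_series q kl ku = Abs_fps (\<lambda>j. smult (q ^ j) (run_weight kl ku j))"

lemma fls_X_times_run_gf:
  assumes "0 < q" "q < 1"
  shows "fls_X * run_gf q kl ku = fps_to_fls (run_series q kl ku)"
proof (intro fls_eqI poly_eqI)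
  fix n m
  have prob: "run_prob q kl ku (int k) (int m) = coeff (run_poly q kl ku k 0) m" for k
    using assms by (simp add: run_prob_def coeff_run_poly pmf_map vimage_def)
  have "coeff (fls_nth (fls_X * run_gf q kl ku) n) m = run_prob q kl ku (n - 1) (int m)"
    by (simp add: fls_X_times_conv_shift run_gf_coeff)
  also have "\<dots> = coeff (fls_nth (fps_to_fls (run_series q kl ku)) n) m"
  proof (cases "n \<le> 0")
    case True
    then show ?thesis by (auto simp: run_prob_def run_series_def coeff_pCons split: nat.splits)
  next
    case False
    then obtain k where "n = int (Suc k)" by (metis gr0_implies_Suc not_le zero_less_imp_eq_int)
    then show ?thesis by (simp add: prob run_series_def nat_add_distrib)
  qed
  finally show "coeff (fls_nth (fls_X * run_gf q kl ku) n) m = coeff (fls_nth (fps_to_fls (run_series q kl ku)) n) m" .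
qed

text \<open>
  The convention for length \<open>-1\<close> is what turns the decomposition by the first run into a plain
  convolution: the all-ones string has probability \<open>q ^ n\<close>, which is the value
  \<open>q ^ n * (1 - q) * (1 / (1 - q))\<close> of the generic summand if the remainder after the (absent)
  first zero is given length \<open>-1\<close> and weight \<open>1 / (1 - q)\<close>.
\<close>

lemma run_series_renewal:
  assumes "q < 1"
  shows "run_series q kl ku = fps_const [:1 / (1 - q):] +
    fps_const [:1 - q:] * fps_X * weight_series q kl ku * run_series q kl ku"
proof (rule fps_ext)
  fix n
  show "run_series q kl ku $ n = (fps_const [:1 / (1 - q):] +
    fps_const [:1 - q:] * fps_X * weight_series q kl ku * run_series q kl ku) $ n"
  proof (cases n)
    case 0
    then show ?thesis by (simp add: run_series_def mult.assoc)
  next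
    case (Suc k)
    have "(fps_const [:1 - q:] * fps_X * weight_series q kl ku * run_series q kl ku) $ Suc k =
       [:1 - q:] * (weight_series q kl ku * run_series q kl ku) $ k"
      by (simp add: mult.assoc)
    also have "(weight_series q kl ku * run_series q kl ku) $ k =
       (\<Sum>j\<le>k. weight_series q kl ku $ j * run_series q kl ku $ (k - j))"
      by (simp add: fps_mult_nth atLeast0AtMost)
    \<comment> \<open>The summand \<open>j = k\<close> meets the conventional coefficient.\<close>
    also have "[:1 - q:] * (\<Sum>j\<le>k. weight_series q kl ku $ j * run_series q kl ku $ (k - j))
       = [:1 - q:] * (\<Sum>j<k. weight_series q kl ku $ j * run_series q kl ku $ (k - j))
       + [:1 - q:] * (weight_series q kl ku $ k * [:1 / (1 - q):])"
      by (simp add: lessThan_Suc_atMost[symmetric] run_series_def distrib_left smult_add_right)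
    also have "(\<Sum>j<k. weight_series q kl ku $ j * run_series q kl ku $ (k - j)) =
       (\<Sum>j<k. smult (q ^ j) (run_weight kl ku j * run_poly q kl ku (k - 1 - j) 0))"
      by (rule sum.cong) (auto simp: weight_series_def run_series_def split: nat.split
          intro!: arg_cong2[where f = smult] arg_cong[where f = "\<lambda>i. _ * run_poly q kl ku i 0"])
    also have "[:1 - q:] * (\<Sum>j<k. smult (q ^ j) (run_weight kl ku j * run_poly q kl ku (k - 1 - j) 0))
       = (\<Sum>j<k. smult (q ^ j * (1 - q)) (run_weight kl ku j * run_poly q kl ku (k - 1 - j) 0))"
      by (simp add: smult_sum_right mult.commute)
    also have "[:1 - q:] * (weight_series q kl ku $ k * [:1 / (1 - q):]) = smult (q ^ k) (run_weight kl ku k)"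
      using assms by (simp add: weight_series_def)
    finally show ?thesis
      using Suc run_poly_unfold[of q kl ku k 0] by (simp add: run_series_def)
  qed
qed

text \<open>
  The coefficient of \<open>x ^ n\<close> on the left is \<open>q ^ n\<close> times the difference of the weights of \<open>n\<close>
  and \<open>n - 1\<close>, and the weight changes only at \<open>kl\<close>, by \<open>y - 1\<close>, and at \<open>ku + 1\<close>, by \<open>1 - y\<close>.
\<close>

lemma weight_series_closed_form:
  assumes "kl \<le> ku"
  shows "(1 - fps_const [:q:] * fps_X) * weight_series q kl ku =
    1 + (fps_const [:0, 1:] - 1) *
      (fps_const [:q:] ^ kl * fps_X ^ kl - fps_const [:q:] ^ (ku + 1) * fps_X ^ (ku + 1))"
proof (rule fps_ext)
  fix n
  have Q: "fps_const [:q:] ^ i = fps_const [:q ^ i:]" for i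
    by (simp add: fps_const_power poly_const_pow)
  have Y: "fps_const [:0, 1::real:] - 1 = fps_const [:-1, 1:]"
    by (rule fps_ext) (simp add: one_pCons)
  show "((1 - fps_const [:q:] * fps_X) * weight_series q kl ku) $ n = (1 + (fps_const [:0, 1:] - 1) *
      (fps_const [:q:] ^ kl * fps_X ^ kl - fps_const [:q:] ^ (ku + 1) * fps_X ^ (ku + 1))) $ n"
    unfolding Q Y using assms
    by (cases n) (auto simp: weight_series_def run_weight_def left_diff_distrib mult.assoc one_pCons)
qed

text \<open>
  With \<open>G\<close> and \<open>W\<close> for \<open>run_series\<close> and \<open>weight_series\<close>, the renewal equation times
  \<open>(1 - Q) * (1 - Q x)\<close> has no \<open>W\<close> any more, and \<open>(1 - Q x) - (1 - Q) x = 1 - x\<close>.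
\<close>

lemma run_series_closed_form:
  fixes q :: real and kl ku :: nat
  assumes "q < 1" "kl \<le> ku"
  defines "Q \<equiv> fps_const [:q:]"
  shows "(1 - Q) * (1 - fps_X - (fps_const [:0, 1:] - 1) * (1 - Q) *
       (Q ^ kl * fps_X ^ (kl + 1) - Q ^ (ku + 1) * fps_X ^ (ku + 2))) * run_series q kl ku =
     1 - Q * fps_X"
proof -
  define x where "x = (fps_X :: real poly fps)"
  define u where "u = (fps_const [:0, 1:] - 1 :: real poly fps)"
  define G where "G = run_series q kl ku"
  define W where "W = weight_series q kl ku"
  define R where "R = fps_const [:1 / (1 - q):]"
  define C where "C = Q ^ kl * x ^ kl - Q ^ (ku + 1) * x ^ (ku + 1)"
  have Q1: "1 - Q = fps_const [:1 - q:]"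
    by (rule fps_ext) (simp add: Q_def one_pCons)
  have R: "(1 - Q) * R = 1"
    using assms by (simp add: Q1 R_def fps_const_mult one_pCons flip: fps_const_1_eq_1)
  have G: "G = R + (1 - Q) * x * W * G"
    using run_series_renewal[OF assms(1)] by (simp add: G_def R_def Q1 x_def W_def)
  have W: "(1 - Q * x) * W = 1 + u * C"
    using weight_series_closed_form[OF assms(2)] by (simp add: W_def C_def u_def Q_def x_def)
  have "(1 - Q) * ((1 - Q * x) * G) = (1 - Q * x) * ((1 - Q) * R) + (1 - Q) * (1 - Q) * x * ((1 - Q * x) * W) * G"
    by (subst G) (simp add: algebra_simps)
  then have "(1 - Q) * ((1 - Q * x) * G) = (1 - Q * x) + (1 - Q) * (1 - Q) * x * (1 + u * C) * G"
    by (simp only: R W mult_1_right)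
  then have "(1 - Q) * (1 - x - u * (1 - Q) * (x * C)) * G = 1 - Q * x"
    by (simp add: algebra_simps)
  moreover have "x * C = Q ^ kl * x ^ (kl + 1) - Q ^ (ku + 1) * x ^ (ku + 2)"
    by (simp add: C_def algebra_simps)
  ultimately show ?thesis by (simp add: x_def u_def G_def)
qed

lemma run_gf_equation:
  fixes q :: real and kl ku :: nat
  assumes "0 < q" "q < 1" "kl \<le> ku"
  defines "Q \<equiv> fls_const [:q:]"
  shows "(1 - Q) * fls_X * (1 - fls_X - (fls_const [:0, 1:] - 1) * (1 - Q) *
       (Q ^ kl * fls_X ^ (kl + 1) - Q ^ (ku + 1) * fls_X ^ (ku + 2))) * run_gf q kl ku =
     1 - Q * fls_X"
proof -
  let ?E = "1 - fls_X - (fls_const [:0, 1:] - 1) * (1 - Q) *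
       (Q ^ kl * fls_X ^ (kl + 1) - Q ^ (ku + 1) * fls_X ^ (ku + 2))"
  have "(1 - Q) * ?E * (fls_X * run_gf q kl ku) = 1 - Q * fls_X"
    using arg_cong[OF run_series_closed_form[OF assms(2,3)], of fps_to_fls]
    by (simp add: fls_X_times_run_gf[OF assms(1,2)] Q_def fls_times_fps_to_fls fps_to_fls_power
        del: power_Suc fps_const_power)
  then show ?thesis by (simp add: mult_ac)
qed

lemma fps_to_fls_dvd_1:
  fixes f :: "'a::comm_ring_1 fps"
  assumes "f $ 0 = 1"
  shows "fps_to_fls f dvd 1"
proof -
  have "f * fps_right_inverse f 1 = 1"
    using assms by (intro fps_right_inverse) simp
  from arg_cong[OF this, of fps_to_fls] show ?thesis
    by (metis dvdI fls_times_fps_to_fls fps_one_to_fls)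
qed

lemma run_gf_denominator_unit:
  fixes q :: real and kl ku :: nat
  assumes "q < 1"
  defines "Q \<equiv> fls_const [:q:]"
  shows "(1 - Q) * fls_X * (1 - fls_X - (fls_const [:0, 1:] - 1) * (1 - Q) *
       (Q ^ kl * fls_X ^ (kl + 1) - Q ^ (ku + 1) * fls_X ^ (ku + 2))) dvd 1"
proof -
  let ?Q = "fps_const [:q:]"
  have "(1 - q) * (1 / (1 - q)) = 1"
    using assms by simp
  then have const_inverse: "[:1 - q:] * [:1 / (1 - q):] = 1"
    by (simp only: mult_pCons_left smult_pCons smult_0_right pCons_0_0 add_0_right mult_zero_left one_pCons)
  have "1 - Q = fls_const [:1 - q:]"
    by (rule fls_eqI) (simp add: Q_def one_pCons)
  then have "(1 - Q) * fls_const [:1 / (1 - q):] = 1"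
    by (simp only: fls_const_mult_const const_inverse fls_const_1)
  then have Q_unit: "1 - Q dvd 1" by (metis dvdI)
  have X_unit: "(fls_X :: real poly fls) dvd 1"
    by (rule dvdI[of _ _ fls_X_inv]) (simp add: fls_X_times_conv_shift)
  have "1 - fls_X - (fls_const [:0, 1:] - 1) * (1 - Q) *
       (Q ^ kl * fls_X ^ (kl + 1) - Q ^ (ku + 1) * fls_X ^ (ku + 2)) =
     fps_to_fls (1 - fps_X - (fps_const [:0, 1:] - 1) * (1 - ?Q) *
       (?Q ^ kl * fps_X ^ (kl + 1) - ?Q ^ (ku + 1) * fps_X ^ (ku + 2)))"
    by (simp add: Q_def fls_times_fps_to_fls fps_to_fls_power del: power_Suc fps_const_power)
  then have "1 - fls_X - (fls_const [:0, 1:] - 1) * (1 - Q) *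
       (Q ^ kl * fls_X ^ (kl + 1) - Q ^ (ku + 1) * fls_X ^ (ku + 2)) dvd 1"
    by (simp only:) (rule fps_to_fls_dvd_1, simp)
  then show ?thesis
    using mult_dvd_mono[OF mult_dvd_mono[OF Q_unit X_unit]] by (metis mult_1_right)
qed

section \<open>Extracting the coefficients of the powers of y\<close>

text \<open>
  Taking the coefficient of \<open>y ^ m\<close> is linear over the Laurent series in \<open>x\<close> with real
  coefficients. These act on the two sides through different types, so linearity is expressed by
  the action of constants and of powers of \<open>x\<close>.
\<close>

lemma y_coeff_add: "y_coeff m (F + G) = y_coeff m F + y_coeff m G"
  by (rule fls_eqI) (simp add: y_coeff_nth)

lemma y_coeff_diff: "y_coeff m (F - G) = y_coeff m F - y_coeff m G"
  by (rule fls_eqI) (simp add: y_coeff_nth)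

lemma y_coeff_fls_X: "y_coeff m (fls_X * F) = fls_X * y_coeff m F"
  by (rule fls_eqI) (simp add: y_coeff_nth fls_X_times_conv_shift)

lemma y_coeff_fls_X_power: "y_coeff m (fls_X ^ n * F) = fls_X ^ n * y_coeff m F"
  by (induction n) (simp_all add: y_coeff_fls_X mult.assoc)

lemma y_coeff_const: "y_coeff m (fls_const [:c:] * F) = fls_const c * y_coeff m F"
  by (rule fls_eqI) (simp add: y_coeff_nth)

lemma y_coeff_const_power: "y_coeff m (fls_const [:c:] ^ n * F) = fls_const c ^ n * y_coeff m F"
  by (induction n) (simp_all add: y_coeff_const mult.assoc)

lemma y_coeff_y_0: "y_coeff 0 (fls_const [:0, 1:] * F) = 0"
  by (rule fls_eqI) (simp add: y_coeff_nth)

lemma y_coeff_y_Suc: "y_coeff (Suc m) (fls_const [:0, 1:] * F) = y_coeff m F"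
  by (rule fls_eqI) (simp add: y_coeff_nth)

lemma y_coeff_1: "y_coeff m 1 = (if m = 0 then 1 else 0)"
  by (rule fls_eqI) (auto simp: y_coeff_nth)

text \<open>
  As a polynomial in \<open>y\<close>, the denominator of the generating function is
  \<open>(1 - Q) x (E - y A)\<close> with \<open>A = (1 - Q) B\<close> and \<open>E = 1 - x + A\<close>. It is linear in \<open>y\<close>, so
  comparing coefficients of \<open>y ^ m\<close> in \<open>run_gf_equation\<close> gives a recurrence of order one.
\<close>

lemma y_coeff_run_gf_recurrence:
  fixes q :: real and kl ku :: nat
  assumes "0 < q" "q < 1" "kl \<le> ku"
  defines "Q \<equiv> fls_const q"
  defines "B \<equiv> Q ^ kl * fls_X ^ (kl + 1) - Q ^ (ku + 1) * fls_X ^ (ku + 2)"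
  defines "F \<equiv> \<lambda>m. y_coeff m (run_gf q kl ku)"
  shows "(1 - Q) * fls_X * ((1 - fls_X + (1 - Q) * B) * F m -
           (case m of 0 \<Rightarrow> 0 | Suc k \<Rightarrow> (1 - Q) * B * F k)) = (case m of 0 \<Rightarrow> 1 - Q * fls_X | Suc k \<Rightarrow> 0)"
proof -
  let ?x = "fls_X :: real poly fls"
  let ?Q = "fls_const [:q:]"
  let ?y = "fls_const [:0, 1:] :: real poly fls"
  let ?P = "run_gf q kl ku"
  let ?B = "?Q ^ kl * ?x ^ (kl + 1) - ?Q ^ (ku + 1) * ?x ^ (ku + 2)"
  have yB: "y_coeff m (?B * H) = B * y_coeff m H" for m H
    by (simp only: left_diff_distrib mult.assoc y_coeff_diff y_coeff_const_power y_coeff_fls_X_power B_def Q_def)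
  have yQ: "y_coeff m ((1 - ?Q) * H) = (1 - Q) * y_coeff m H" for m H
    by (simp only: left_diff_distrib mult_1_left y_coeff_diff y_coeff_const Q_def)
  have regroup: "(1 - c) * (x * ((P - x * P + (1 - c) * (b * P)) - y * ((1 - c) * (b * P)))) =
     (1 - c) * x * (1 - x - (y - 1) * (1 - c) * b) * P" for b c x y P :: "real poly fls"
    by (simp add: algebra_simps)
  have "(1 - ?Q) * (?x * ((?P - ?x * ?P + (1 - ?Q) * (?B * ?P)) - ?y * ((1 - ?Q) * (?B * ?P)))) =
     (1 - ?Q) * ?x * (1 - ?x - (?y - 1) * (1 - ?Q) * ?B) * ?P"
    by (rule regroup)
  also have "\<dots> = 1 - ?Q * ?x"
    by (rule run_gf_equation[OF assms(1-3)])
  finally have eq: "(1 - ?Q) * (?x * ((?P - ?x * ?P + (1 - ?Q) * (?B * ?P)) - ?y * ((1 - ?Q) * (?B * ?P)))) = 1 - ?Q * (?x * 1)"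
    by simp
  note yc = yQ yB y_coeff_add y_coeff_diff y_coeff_fls_X y_coeff_const y_coeff_1 y_coeff_y_0 y_coeff_y_Suc
  show ?thesis
  proof (cases m)
    case 0
    show ?thesis
      using arg_cong[OF eq, of "y_coeff 0"] unfolding yc
      by (simp add: 0 F_def yc algebra_simps Q_def)
  next
    case (Suc k)
    show ?thesis
      using arg_cong[OF eq, of "y_coeff m"] unfolding yc Suc
      by (simp add: yc F_def algebra_simps)
  qed
qed

text \<open>Over the field of real Laurent series the recurrence is geometric, with ratio \<open>A / E\<close>.\<close>

lemma y_coeff_run_gf:
  fixes q :: real and kl ku :: nat
  assumes "0 < q" "q < 1" "kl \<le> ku"
  defines "Q \<equiv> fls_const q"
  defines "B \<equiv> Q ^ kl * fls_X ^ (kl + 1) - Q ^ (ku + 1) * fls_X ^ (ku + 2)"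
  shows "y_coeff m (run_gf q kl ku) =
    (1 - Q) powi (int m - 1) * (1 - Q * fls_X) * B ^ m / (fls_X * (1 - fls_X + (1 - Q) * B) ^ (m + 1))"
proof -
  define E where "E = 1 - fls_X + (1 - Q) * B"
  have nz: "1 - Q \<noteq> 0"
  proof
    assume "1 - Q = 0"
    from arg_cong[OF this, of "\<lambda>f. fls_nth f 0"] show False using assms by simp
  qed
  have "E = fps_to_fls (1 - fps_X + (1 - fps_const q) *
      (fps_const q ^ kl * fps_X ^ (kl + 1) - fps_const q ^ (ku + 1) * fps_X ^ (ku + 2)))"
    by (simp add: E_def B_def Q_def fls_times_fps_to_fls fps_to_fls_power del: power_Suc fps_const_power)
  then have "fls_nth E 0 = 1" by simp
  then have "E \<noteq> 0" by auto
  note recurrence = y_coeff_run_gf_recurrence[OF assms(1-3), folded Q_def, folded B_def, folded E_def]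
  have "y_coeff m (run_gf q kl ku) = (1 - Q) powi (int m - 1) * (1 - Q * fls_X) * B ^ m / (fls_X * E ^ (m + 1))"
  proof (induction m)
    case 0
    have "(1 - Q) * fls_X * (E * y_coeff 0 (run_gf q kl ku)) = 1 - Q * fls_X"
      using recurrence[of 0] by simp
    then have "y_coeff 0 (run_gf q kl ku) = (1 - Q * fls_X) / ((1 - Q) * fls_X * E)"
      using nz \<open>E \<noteq> 0\<close> by (simp add: eq_divide_eq mult_ac)
    then show ?case
      by (simp add: power_int_minus divide_inverse mult_ac)
  next
    case (Suc k)
    have "(1 - Q) * fls_X * (E * y_coeff (Suc k) (run_gf q kl ku) - (1 - Q) * B * y_coeff k (run_gf q kl ku)) = 0"
      using recurrence[of "Suc k"] by simp
    then have "y_coeff (Suc k) (run_gf q kl ku) = (1 - Q) * B * y_coeff k (run_gf q kl ku) / E"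
      using nz \<open>E \<noteq> 0\<close> by (simp add: eq_divide_eq mult_ac)
    moreover have "(1 - Q) powi (int (Suc k) - 1) = (1 - Q) * (1 - Q) powi (int k - 1)"
      using nz power_int_add[of "1 - Q" 1 "int k - 1"] by simp
    ultimately show ?case
      by (simp add: Suc mult_ac)
  qed
  then show ?thesis by (simp only: E_def)
qed

theorem mainTheorem11:
  fixes q :: real and kl ku :: nat
  assumes "0 < q" and "q < 1" and "kl \<le> ku"
  shows "(let x = (fls_X :: real poly fls);
             y = fls_const [:0, 1:];
             Q = fls_const [:q:];
             D = (1 - Q) * x *
                 (1 - x - (y - 1) * (1 - Q) * (Q ^ kl * x ^ (kl + 1) - Q ^ (ku + 1) * x ^ (ku + 2)))
         in D dvd 1 \<and> run_gf q kl ku = unit_quotient (1 - Q * x) D)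
    \<and> (\<forall>m. let x = (fls_X :: real fls);
             Q = fls_const q;
             B = Q ^ kl * x ^ (kl + 1) - Q ^ (ku + 1) * x ^ (ku + 2)
         in y_coeff m (run_gf q kl ku) =
            (1 - Q) powi (int m - 1) * (1 - Q * x) * B ^ m / (x * (1 - x + (1 - Q) * B) ^ (m + 1)))"
proof -
  note unit = run_gf_denominator_unit[OF assms(2), of kl ku]
  show ?thesis
    unfolding Let_def unit_quotient_eq_iff[OF unit]
    using unit run_gf_equation[OF assms] y_coeff_run_gf[OF assms]
    by (simp add: mult.commute)
qed

end
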